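(* Let $\Sigma$ be a straight line in $\mathbb{R}^2$, and let $R_L, R_R$ be the two open half-planes that it determines. Let $X_L, X_R$ be two linear (i.e. affine) Hamiltonian vector fields on $\mathbb{R}^2$, each of which has an isolated singular point (necessarily a center or a saddle, not required to lie in the corresponding zone). Consider the planar piecewise linear Hamiltonian differential system with two zones defined by $X_L$ on $\overline{R_L}$ and by $X_R$ on $\overline{R_R}$, and suppose it is continuous, i.e. $X_L(p)=X_R(p)$ for every $p\in\Sigma$. Then this piecewise system has no limit cycles.
   Context: A linear Hamiltonian vector field on $\mathbb{R}^2$ here means a vector field of the form $X(x,y)=(ax+by+\alpha,\; cx-ay+\beta)$ with $a,b,c,\alpha,\beta\in\mathbb{R}$. It is the Hamiltonian vector field $(\partial_y H,-\partial_x H)$ of $H(x,y)=\frac{b}{2}y^2-\frac{c}{2}x^2+axy+\alpha y-\beta x$. Its singular point is isolated if and only if $a^2+bc\neq 0$; it is then a center if $a^2+bc<0$ and a saddle if $a^2+bc>0$. The singular point of each vector field is considered in the whole plane, so it may lie outside the zone in which that vector field is used. A limit cycle is a periodic orbit of the piecewise system that is isolated in the set of all its periodic orbits. *)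

theory Defs
  imports "HOL-Analysis.Analysis"
begin

type_synonym plane = "real \<times> real"

definition linear_hamiltonian :: "(plane \<Rightarrow> plane) \<Rightarrow> bool" where
  "linear_hamiltonian X \<longleftrightarrow>
     (\<exists>a b c \<alpha> \<beta>. \<forall>x y. X (x, y) = (a * x + b * y + \<alpha>, c * x - a * y + \<beta>))"

definition has_isolated_singular_point :: "(plane \<Rightarrow> plane) \<Rightarrow> bool" where
  "has_isolated_singular_point X \<longleftrightarrow> (\<exists>p. p isolated_in {q. X q = 0})"

text \<open>
  The piecewise field that is X on the closed zone and Y off it. When the zone is an open
  half-plane and X, Y agree on the boundary line, it equals Y on the whole closure of the
  opposite half-plane, so the asymmetry of the definition is immaterial.
\<close>

definition piecewise_field ::
    "plane set \<Rightarrow> (plane \<Rightarrow> plane) \<Rightarrow> (plane \<Rightarrow> plane) \<Rightarrow> plane \<Rightarrow> plane" where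
  "piecewise_field R X Y p = (if p \<in> closure R then X p else Y p)"

definition is_solution :: "(plane \<Rightarrow> plane) \<Rightarrow> (real \<Rightarrow> plane) \<Rightarrow> bool" where
  "is_solution X \<gamma> \<longleftrightarrow> (\<forall>t. (\<gamma> has_vector_derivative X (\<gamma> t)) (at t))"

text \<open>
  Orbits are point sets. Equilibria are not periodic orbits, hence the exclusion of constant
  solutions.
\<close>

definition periodic_orbits :: "(plane \<Rightarrow> plane) \<Rightarrow> plane set set" where
  "periodic_orbits X =
     {range \<gamma> | \<gamma>. is_solution X \<gamma> \<and> \<not> \<gamma> constant_on UNIV \<and> (\<exists>T>0. \<forall>t. \<gamma> (t + T) = \<gamma> t)}"

text \<open>
  Closeness of compact sets in the sense of the Hausdorff distance: each set lies in the open
  neighbourhood of radius e of the other.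
\<close>

definition hausdorff_close :: "real \<Rightarrow> plane set \<Rightarrow> plane set \<Rightarrow> bool" where
  "hausdorff_close e A B \<longleftrightarrow>
     (\<forall>p\<in>A. \<exists>q\<in>B. dist p q < e) \<and> (\<forall>q\<in>B. \<exists>p\<in>A. dist p q < e)"

text \<open>
  Isolation in the set of periodic orbits refers to the Hausdorff distance. An orbit with a
  neighbourhood that contains (or that meets) no other periodic orbit is isolated in this sense,
  so the absence of limit cycles as defined here implies their absence under those variants.
\<close>

definition limit_cycle :: "(plane \<Rightarrow> plane) \<Rightarrow> plane set \<Rightarrow> bool" where
  "limit_cycle X C \<longleftrightarrow>
     C \<in> periodic_orbits X \<and>
     (\<exists>e>0. \<forall>D\<in>periodic_orbits X. hausdorff_close e C D \<longrightarrow> D = C)"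

end

theory Submission
  imports Defs
begin

text \<open>
  A continuous piecewise linear Hamiltonian field is a Lipschitz field that has a single
  continuously differentiable Hamiltonian \<open>H\<close> on the whole plane, and periodic orbits of such a
  field are never isolated.

  For the first claim, the difference \<open>X\<^sub>R - X\<^sub>L\<close> is affine, vanishes on the line
  \<open>n \<bullet> p = k\<close> and has trace zero. This forces it to be \<open>n \<bullet> p - k\<close> times a constant vector parallel
  to the line (\<open>continuous_hamiltonian_pair_difference\<close>). The piecewise field is therefore \<open>X\<^sub>L\<close> plus
  \<open>max (n \<bullet> p - k) 0\<close> times that vector, and its Hamiltonian is the quadratic Hamiltonian of \<open>X\<^sub>L\<close>
  plus a multiple of the square of this positive part.

  For the second claim (\<open>lipschitz_hamiltonian_no_limit_cycle\<close>), consider the return map to a short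
  section through a point of a periodic orbit. It preserves \<open>H\<close>, and \<open>H\<close> is strictly monotone
  along the section because the section is transversal to the flow. Hence the return map is the
  identity: all nearby orbits close up, and they differ from the given one because they lie on
  other levels of \<open>H\<close>.

  The return map rests on three facts about globally Lipschitz fields: global existence of
  solutions (\<open>lipschitz_solution_exists\<close>), their uniqueness (\<open>solution_unique\<close>), and the exponential
  bound on the distance of two solutions (\<open>solution_dist_forward\<close>).
\<close>

section \<open>Uniqueness and dependence on the initial value\<close>

lemma solution_reverse_time:
  assumes "is_solution X \<phi>"
  shows "is_solution (\<lambda>p. - X p) (\<lambda>t. \<phi> (- t))"
proof -
  have "((\<lambda>t. \<phi> (- t)) has_vector_derivative (-1) *\<^sub>R X (\<phi> (- t))) (at t)" for t
    by (rule vector_diff_chain_at[of uminus "-1" t \<phi> "X (\<phi> (- t))", unfolded o_def])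
       (use assms in \<open>auto simp: is_solution_def intro!: derivative_eq_intros\<close>)
  then show ?thesis
    by (simp add: is_solution_def)
qed

lemma solution_shift_time:
  assumes "is_solution X \<phi>"
  shows "is_solution X (\<lambda>t. \<phi> (t + c))"
proof -
  have "((\<lambda>t. \<phi> (t + c)) has_vector_derivative 1 *\<^sub>R X (\<phi> (t + c))) (at t)" for t
    by (rule vector_diff_chain_at[of "\<lambda>t. t + c" 1 t \<phi> "X (\<phi> (t + c))", unfolded o_def])
       (use assms in \<open>auto simp: is_solution_def intro!: derivative_eq_intros\<close>)
  then show ?thesis
    by (simp add: is_solution_def)
qed

lemma solution_continuous:
  assumes "is_solution X \<phi>"
  shows "continuous_on S \<phi>"
  using assms unfolding is_solution_def
  by (meson continuous_at_imp_continuous_on has_vector_derivative_continuous)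

text \<open>
  Gronwall's inequality in differential form: by the Lipschitz bound the derivative of
  \<open>\<parallel>\<phi> - \<psi>\<parallel>\<^sup>2\<close> is at most \<open>2 K\<close> times that function, so multiplied by \<open>exp (- 2 K t)\<close> it
  decreases.
\<close>

lemma solution_dist_forward:
  assumes X: "K-lipschitz_on UNIV X"
    and \<phi>: "is_solution X \<phi>" and \<psi>: "is_solution X \<psi>" and "0 \<le> t"
  shows "dist (\<phi> t) (\<psi> t) \<le> exp (K * t) * dist (\<phi> 0) (\<psi> 0)"
proof -
  define w where "w s = \<phi> s - \<psi> s" for s
  define f where "f s = exp (- 2 * K * s) * (w s \<bullet> w s)" for s
  have "\<exists>y. (f has_real_derivative y) (at s) \<and> y \<le> 0" for s
  proof -
    have "(w has_vector_derivative X (\<phi> s) - X (\<psi> s)) (at s)"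
      unfolding w_def using \<phi> \<psi> by (auto simp: is_solution_def intro!: derivative_intros)
    then have "(f has_real_derivative
        exp (- 2 * K * s) * (2 * (w s \<bullet> (X (\<phi> s) - X (\<psi> s))))
        + exp (- 2 * K * s) * (- 2 * K) * (w s \<bullet> w s)) (at s)"
      unfolding f_def has_vector_derivative_def has_field_derivative_def
      by (auto intro!: derivative_eq_intros simp: inner_commute algebra_simps)
    moreover have "w s \<bullet> (X (\<phi> s) - X (\<psi> s)) \<le> K * (w s \<bullet> w s)"
    proof -
      have "w s \<bullet> (X (\<phi> s) - X (\<psi> s)) \<le> norm (w s) * norm (X (\<phi> s) - X (\<psi> s))"
        by (rule norm_cauchy_schwarz)
      also have "\<dots> \<le> norm (w s) * (K * norm (w s))"
        using lipschitz_onD[OF X, of "\<phi> s" "\<psi> s"]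
        by (intro mult_left_mono) (auto simp: w_def dist_norm)
      finally show ?thesis
        by (simp add: dot_square_norm power2_eq_square mult.left_commute)
    qed
    then have "exp (- 2 * K * s) * (2 * (w s \<bullet> (X (\<phi> s) - X (\<psi> s))) - 2 * (K * (w s \<bullet> w s))) \<le> 0"
      by (intro mult_nonneg_nonpos) auto
    ultimately show ?thesis
      by (intro exI conjI) (auto simp: algebra_simps)
  qed
  then have "f t \<le> f 0"
    using DERIV_nonpos_imp_nonincreasing[OF \<open>0 \<le> t\<close>, of f] by blast
  then have "norm (w t) ^ 2 \<le> (exp (K * t) * norm (w 0)) ^ 2"
    by (simp add: f_def power_mult_distrib exp_minus field_simps dot_square_norm
        flip: exp_of_nat_mult exp_double)
  then have "norm (w t) \<le> exp (K * t) * norm (w 0)"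
    by (rule power2_le_imp_le) simp
  then show ?thesis
    by (simp add: w_def dist_norm)
qed

lemma solution_unique:
  assumes X: "K-lipschitz_on UNIV X"
    and \<phi>: "is_solution X \<phi>" and \<psi>: "is_solution X \<psi>" and "\<phi> 0 = \<psi> 0"
  shows "\<phi> = \<psi>"
proof
  fix t
  have X': "K-lipschitz_on UNIV (\<lambda>p. - X p)"
    using X by (rule lipschitz_on_minus)
  show "\<phi> t = \<psi> t"
  proof (cases "0 \<le> t")
    case True
    then show ?thesis
      using solution_dist_forward[OF X \<phi> \<psi>, of t] \<open>\<phi> 0 = \<psi> 0\<close> by simp
  next
    case False
    then show ?thesis
      using solution_dist_forward[OF X' solution_reverse_time[OF \<phi>] solution_reverse_time[OF \<psi>], of "- t"]
        \<open>\<phi> 0 = \<psi> 0\<close> by simp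
  qed
qed

lemma solution_periodic:
  assumes "K-lipschitz_on UNIV X" and "is_solution X \<phi>" and "\<phi> T = \<phi> 0"
  shows "\<phi> (t + T) = \<phi> t"
  using solution_unique[OF assms(1) solution_shift_time[OF assms(2), of T] assms(2)] assms(3)
  by (metis add_0)

text \<open>
  A whole periodic orbit is traced over a bounded time interval, where the exponential bound on
  the distance of two solutions is uniform. This is how closeness of initial values becomes
  Hausdorff closeness of orbits.
\<close>

lemma range_periodic:
  fixes \<phi> :: "real \<Rightarrow> 'a"
  assumes per: "\<And>t. \<phi> (t + T) = \<phi> t" and "T > 0"
  shows "range \<phi> = \<phi> ` {0..T}"
proof -
  have "\<phi> t \<in> \<phi> ` {0..T}" for t
  proof -
    have 1: "\<phi> (s + real k * T) = \<phi> s" for s k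
    proof (induction k)
      case (Suc k)
      then show ?case using per[of "s + real k * T"] by (simp add: algebra_simps)
    qed simp
    define m where "m = \<lfloor>t / T\<rfloor>"
    define r where "r = t - of_int m * T"
    have "\<phi> r = \<phi> t"
    proof (cases "m \<ge> 0")
      case True
      then show ?thesis using 1[of r "nat m"] by (simp add: r_def)
    next
      case False
      then show ?thesis using 1[of t "nat (- m)"] by (simp add: r_def)
    qed
    moreover have "r = frac (t / T) * T"
      using \<open>T > 0\<close> by (simp add: r_def m_def frac_def field_simps)
    then have "r \<in> {0..T}"
      using \<open>T > 0\<close> frac_lt_1[of "t / T"] frac_ge_0[of "t / T"] by (auto simp: mult_le_cancel_right1)
    ultimately show ?thesis by (metis imageI)
  qed
  then show ?thesis by blast
qed

section \<open>Global existence of solutions\<close>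

text \<open>
  The estimate that makes Picard's integral operator bounded and contracting in the norm
  \<open>sup exp (- 2 K t) \<parallel>g t\<parallel>\<close>: integrating the weight \<open>exp (2 K s)\<close> gains the factor \<open>1 / (2 K)\<close>.
\<close>

lemma weighted_integral_bound:
  fixes h :: "real \<Rightarrow> 'a::banach"
  assumes "K > 0" and "M \<ge> 0" and cont: "continuous_on {0..t} h"
    and bound: "\<And>s. 0 \<le> s \<Longrightarrow> s \<le> t \<Longrightarrow> norm (h s) \<le> M * exp (2 * K * s)"
  shows "norm (exp (- 2 * K * t) *\<^sub>R integral {0..t} h) \<le> M / (2 * K)"
proof (cases "0 \<le> t")
  case True
  have I: "((\<lambda>s. M * exp (2 * K * s)) has_integral
      (M / (2 * K) * exp (2 * K * t) - M / (2 * K) * exp (2 * K * 0))) {0..t}"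
    using \<open>K > 0\<close> True
    by (intro fundamental_theorem_of_calculus)
       (auto intro!: derivative_eq_intros simp flip: has_real_derivative_iff_has_vector_derivative)
  have "norm (integral {0..t} h) \<le> integral {0..t} (\<lambda>s. M * exp (2 * K * s))"
    using I bound has_integral_integrable[OF I]
    by (intro integral_norm_bound_integral integrable_continuous_real[OF cont]) auto
  also have "\<dots> \<le> M / (2 * K) * exp (2 * K * t)"
    using integral_unique[OF I] \<open>K > 0\<close> \<open>M \<ge> 0\<close> by simp
  finally have "exp (- 2 * K * t) * norm (integral {0..t} h)
      \<le> exp (- 2 * K * t) * (M / (2 * K) * exp (2 * K * t))"
    by (intro mult_left_mono) auto
  then show ?thesis
    by (simp add: exp_minus field_simps)
next
  case False
  then show ?thesis using assms by simp
qed

text \<open>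
  Picard's iteration for all positive times at once. Writing the unknown solution as
  \<open>p + exp (2 K t) g t\<close>, the weighted sup norm becomes the sup norm of \<open>g\<close>, so that the fixed
  point can be sought in the Banach space of bounded continuous functions, where the operator
  has contraction constant \<open>1 / 2\<close> and no time step has to be small.
\<close>

lemma lipschitz_forward_solution_exists:
  fixes X :: "'a::banach \<Rightarrow> 'a"
  assumes X: "K-lipschitz_on UNIV X" and "K > 0"
  shows "\<exists>\<phi>. \<phi> 0 = p \<and> (\<forall>t\<ge>0. (\<phi> has_vector_derivative X (\<phi> t)) (at t within {0..}))"
proof -
  define h where "h g s = X (p + exp (2 * K * s) *\<^sub>R apply_bcontfun g s)" for g s
  \<comment> \<open>Replacing \<open>t\<close> by \<open>max t 0\<close> makes the iterates continuous functions on the whole real line.\<close>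
  define F where "F g t = exp (- 2 * K * max t 0) *\<^sub>R integral {0..max t 0} (h g)" for g t
  have cont_X: "continuous_on UNIV X"
    using X by (rule lipschitz_on_continuous_on)
  have cont_h: "continuous_on S (h g)" for g S
    unfolding h_def by (intro continuous_on_compose2[OF cont_X] continuous_intros) auto
  have integral_deriv:
    "((\<lambda>u. integral {0..u} (h g)) has_vector_derivative h g t) (at t within {0..})"
    if "t \<ge> 0" for g t
  proof -
    have "((\<lambda>u. integral {0..u} (h g)) has_vector_derivative h g t) (at t within {0..t + 1})"
      using that by (intro integral_has_vector_derivative cont_h) auto
    moreover have "at t within {0..t + 1} = at t within {0..}"
      by (rule at_within_nhd[of t "{..<t + 1}"]) auto
    ultimately show ?thesis by simp
  qed
  have bound_F: "norm (F g t) \<le> (norm (X p) + K * norm g) / (2 * K)" for g t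
    unfolding F_def
  proof (rule weighted_integral_bound[OF \<open>K > 0\<close> _ cont_h])
    fix s :: real assume s: "0 \<le> s"
    have "norm (h g s) \<le> norm (X p) + norm (h g s - X p)"
      by (metis norm_triangle_sub)
    also have "norm (h g s - X p) \<le> K * (exp (2 * K * s) * norm (apply_bcontfun g s))"
      using lipschitz_onD[OF X, of "p + exp (2 * K * s) *\<^sub>R apply_bcontfun g s" p]
      by (simp add: h_def dist_norm)
    also have "norm (apply_bcontfun g s) \<le> norm g"
      by (rule norm_bounded)
    also have "norm (X p) \<le> norm (X p) * exp (2 * K * s)"
      using s \<open>K > 0\<close> by (simp add: mult_le_cancel_left1)
    finally show "norm (h g s) \<le> (norm (X p) + K * norm g) * exp (2 * K * s)"
      using \<open>K > 0\<close> by (simp add: algebra_simps)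
  qed (use \<open>K > 0\<close> in auto)
  have cont_F: "continuous_on UNIV (F g)" for g
  proof -
    have "continuous_on {0..} (\<lambda>u. integral {0..u} (h g))"
      using has_vector_derivative_continuous[OF integral_deriv]
      by (simp add: continuous_on_eq_continuous_within)
    then show ?thesis
      unfolding F_def
      by (intro continuous_intros continuous_on_compose2[where f = "\<lambda>t. max t 0"]) auto
  qed
  define \<Phi> where "\<Phi> g = Bcontfun (F g)" for g
  have \<Phi>: "apply_bcontfun (\<Phi> g) = F g" for g
    unfolding \<Phi>_def using bcontfun_normI[OF cont_F bound_F] by (simp add: Bcontfun_inverse)
  have "dist (\<Phi> g) (\<Phi> g') \<le> 1 / 2 * dist g g'" for g g'
  proof (rule dist_bound)
    fix t
    have "F g t - F g' t = exp (- 2 * K * max t 0) *\<^sub>R integral {0..max t 0} (\<lambda>s. h g s - h g' s)"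
      unfolding F_def using integrable_continuous_real[OF cont_h]
      by (simp add: Henstock_Kurzweil_Integration.integral_diff scaleR_diff_right)
    also have "norm \<dots> \<le> (K * dist g g') / (2 * K)"
    proof (rule weighted_integral_bound[OF \<open>K > 0\<close>])
      fix s :: real
      have "norm (h g s - h g' s) \<le> K * (exp (2 * K * s) * dist (apply_bcontfun g s) (apply_bcontfun g' s))"
        using lipschitz_onD[OF X, of "p + exp (2 * K * s) *\<^sub>R apply_bcontfun g s"
            "p + exp (2 * K * s) *\<^sub>R apply_bcontfun g' s"]
        by (simp add: h_def dist_norm flip: scaleR_diff_right)
      also have "dist (apply_bcontfun g s) (apply_bcontfun g' s) \<le> dist g g'"
        by (rule dist_bounded)
      finally show "norm (h g s - h g' s) \<le> K * dist g g' * exp (2 * K * s)"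
        using \<open>K > 0\<close> by (simp add: mult_ac)
    qed (use \<open>K > 0\<close> in \<open>auto intro: continuous_on_diff cont_h\<close>)
    finally show "dist (apply_bcontfun (\<Phi> g) t) (apply_bcontfun (\<Phi> g') t) \<le> 1 / 2 * dist g g'"
      using \<open>K > 0\<close> by (simp add: \<Phi> dist_norm)
  qed
  then obtain g where g: "\<Phi> g = g"
    using banach_fix_type[of "1 / 2" \<Phi>] by auto
  define \<phi> where "\<phi> t = p + integral {0..t} (h g)" for t
  have "h g t = X (\<phi> t)" if "t \<ge> 0" for t
  proof -
    have "apply_bcontfun g t = exp (- 2 * K * t) *\<^sub>R integral {0..t} (h g)"
      using that \<Phi>[of g] by (simp add: g F_def)
    then show ?thesis
      by (simp add: h_def[of g t] \<phi>_def exp_minus)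
  qed
  then have "(\<phi> has_vector_derivative X (\<phi> t)) (at t within {0..})" if "t \<ge> 0" for t
    using has_vector_derivative_add[OF has_vector_derivative_const[of p] integral_deriv[OF that, of g]]
      that by (simp flip: \<phi>_def)
  moreover have "\<phi> 0 = p"
    by (simp add: \<phi>_def)
  ultimately show ?thesis
    by blast
qed

text \<open>
  The backward half of the solution is a forward solution of \<open>- X\<close>, run in reverse; at time 0
  the one-sided derivatives of the two halves agree.
\<close>

lemma lipschitz_solution_exists:
  assumes X: "K-lipschitz_on UNIV X"
  shows "\<exists>\<phi>. is_solution X \<phi> \<and> \<phi> 0 = p"
proof -
  \<comment> \<open>The forward existence result wants a positive constant, and \<open>K\<close> may vanish.\<close>
  have "K + 1 > 0"
    using lipschitz_on_nonneg[OF X] by simp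
  have X1: "(K + 1)-lipschitz_on UNIV X"
    by (rule lipschitz_on_mono[OF X]) auto
  then have X2: "(K + 1)-lipschitz_on UNIV (\<lambda>p. - X p)"
    by (rule lipschitz_on_minus)
  obtain \<phi> where \<phi>: "\<phi> 0 = p"
      "\<And>t. t \<ge> 0 \<Longrightarrow> (\<phi> has_vector_derivative X (\<phi> t)) (at t within {0..})"
    using lipschitz_forward_solution_exists[OF X1 \<open>K + 1 > 0\<close>, of p] by auto
  obtain \<psi> where \<psi>: "\<psi> 0 = p"
      "\<And>t. t \<ge> 0 \<Longrightarrow> (\<psi> has_vector_derivative - X (\<psi> t)) (at t within {0..})"
    using lipschitz_forward_solution_exists[OF X2 \<open>K + 1 > 0\<close>, of p] by auto
  have \<psi>': "((\<lambda>t. \<psi> (- t)) has_vector_derivative X (\<psi> (- t))) (at t within {..0})" if "t \<le> 0" for t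
  proof -
    have "((\<lambda>t. \<psi> (- t)) has_vector_derivative (-1) *\<^sub>R (- X (\<psi> (- t)))) (at t within {..0})"
    proof (rule vector_diff_chain_within[of uminus "-1" t "{..0}" \<psi> "- X (\<psi> (- t))", unfolded o_def])
      show "(uminus has_vector_derivative - 1) (at t within {..0})"
        by (intro derivative_intros)
      show "(\<psi> has_vector_derivative - X (\<psi> (- t))) (at (- t) within uminus ` {..0})"
        using \<psi>(2)[of "- t"] that by simp
    qed
    then show ?thesis by simp
  qed
  define \<gamma> where "\<gamma> = (\<lambda>t. if t \<in> {0..} then \<phi> t else \<psi> (- t))"
  have "(\<gamma> has_vector_derivative X (\<gamma> t)) (at t)" for t
  proof -
    have "((\<lambda>t. if t \<in> {0..} then \<phi> t else \<psi> (- t)) has_vector_derivative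
        (if t \<in> {0..} then X (\<phi> t) else X (\<psi> (- t)))) (at t within UNIV)"
    proof (rule has_vector_derivative_If_within_closures[where T = "{..0}"])
      have [simp]: "{0..} \<union> (closure {0..} \<inter> closure {..0}) = {0::real..}"
        "{..0} \<union> (closure {0..} \<inter> closure {..0}) = {..0::real}"
        by auto
      show "(\<phi> has_vector_derivative X (\<phi> t)) (at t within {0..} \<union> (closure {0..} \<inter> closure {..0}))"
        if "t \<in> {0..} \<union> (closure {0..} \<inter> closure {..0})"
        using that \<phi>(2) by simp
      show "((\<lambda>t. \<psi> (- t)) has_vector_derivative X (\<psi> (- t)))
          (at t within {..0} \<union> (closure {0..} \<inter> closure {..0}))"
        if "t \<in> {..0} \<union> (closure {0..} \<inter> closure {..0})"
        using that \<psi>' by simp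
    qed (use \<phi>(1) \<psi>(1) in auto)
    moreover have "(if t \<in> {0..} then X (\<phi> t) else X (\<psi> (- t))) = X (\<gamma> t)"
      by (simp add: \<gamma>_def)
    ultimately show ?thesis
      by (simp only: \<gamma>_def)
  qed
  then show ?thesis
    using \<phi>(1) by (intro exI[of _ \<gamma>]) (simp add: is_solution_def \<gamma>_def)
qed

section \<open>Periodic orbits of planar Hamiltonian fields\<close>

text \<open>
  Here and below, the condition on \<open>H\<close> says that \<open>X\<close> is its Hamiltonian field
  \<open>(\<partial>\<^sub>y H, - \<partial>\<^sub>x H)\<close>; it is stated through the total derivative, since the piecewise Hamiltonian
  is not given by a single formula.
\<close>

lemma solution_conserves_hamiltonian:
  fixes H :: "plane \<Rightarrow> real"
  assumes H: "\<And>p. (H has_derivative (\<lambda>v. fst (X p) * snd v - snd (X p) * fst v)) (at p)"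
    and \<phi>: "is_solution X \<phi>"
  shows "H (\<phi> s) = H (\<phi> t)"
proof -
  have "((\<lambda>t. H (\<phi> t)) has_real_derivative 0) (at t)" for t
  proof -
    have "(\<phi> has_derivative (\<lambda>h. h *\<^sub>R X (\<phi> t))) (at t)"
      using \<phi> by (simp add: is_solution_def has_vector_derivative_def)
    from diff_chain_at[OF this H] show ?thesis
      by (simp add: has_field_derivative_def o_def algebra_simps flip: lambda_zero)
  qed
  then show ?thesis
    using DERIV_isconst_all[of "\<lambda>t. H (\<phi> t)" s t] by blast
qed

lemma norm_quarter_turn:
  fixes f :: plane
  shows "norm (- snd f, fst f) = norm f"
  by (simp add: norm_prod_def add.commute)

text \<open>
  On a line orthogonal to \<open>f\<close>, the derivative of \<open>H\<close> along the quarter turn of \<open>f\<close> is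
  \<open>X \<bullet> f\<close>. Hence \<open>H\<close> separates the points of a section as long as the field crosses
  it everywhere in the same direction.
\<close>

lemma hamiltonian_increasing_on_section:
  fixes H :: "plane \<Rightarrow> real" and p f :: plane
  assumes H: "\<And>p. (H has_derivative (\<lambda>v. fst (X p) * snd v - snd (X p) * fst v)) (at p)"
    and transversal: "\<And>q. dist q p < r \<Longrightarrow> X q \<bullet> f > 0"
    and "s < s'" and "\<bar>s\<bar> * norm f < r" and "\<bar>s'\<bar> * norm f < r"
  shows "H (p + s *\<^sub>R (- snd f, fst f)) < H (p + s' *\<^sub>R (- snd f, fst f))"
proof -
  let ?\<sigma> = "\<lambda>s. p + s *\<^sub>R (- snd f, fst f)"
  have "\<exists>y. ((\<lambda>s. H (?\<sigma> s)) has_real_derivative y) (at u) \<and> y > 0" if "s \<le> u" "u \<le> s'" for u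
  proof -
    have "(?\<sigma> has_derivative (\<lambda>h. h *\<^sub>R (- snd f, fst f))) (at u)"
      by (auto intro!: derivative_eq_intros)
    from diff_chain_at[OF this H]
    have "((\<lambda>s. H (?\<sigma> s)) has_real_derivative X (?\<sigma> u) \<bullet> f) (at u)"
      unfolding has_field_derivative_def o_def
      by (rule has_derivative_eq_rhs) (simp add: fun_eq_iff inner_prod_def algebra_simps)
    moreover have "\<bar>u\<bar> \<le> max \<bar>s\<bar> \<bar>s'\<bar>"
      using that by linarith
    then have "\<bar>u\<bar> * norm f \<le> max \<bar>s\<bar> \<bar>s'\<bar> * norm f"
      by (rule mult_right_mono) simp
    then have "dist (?\<sigma> u) p < r"
      using assms(4,5)
      by (auto simp: dist_norm norm_quarter_turn max_def simp del: scaleR_Pair split: if_splits)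
    ultimately show ?thesis
      using transversal by blast
  qed
  then show ?thesis
    by (rule DERIV_pos_imp_increasing[OF \<open>s < s'\<close>])
qed

lemma orthogonal_in_plane:
  fixes v f :: plane
  assumes "f \<noteq> 0" and "v \<bullet> f = 0"
  obtains s where "v = s *\<^sub>R (- snd f, fst f)"
proof -
  have nz: "fst f * fst f + snd f * snd f \<noteq> 0"
    using \<open>f \<noteq> 0\<close> by (simp add: prod_eq_iff sum_squares_eq_zero_iff)
  have 0: "fst v * fst f + snd v * snd f = 0"
    using assms(2) by (simp add: inner_prod_def)
  define s where "s = (snd v * fst f - fst v * snd f) / (fst f * fst f + snd f * snd f)"
  have "fst v * (fst f * fst f + snd f * snd f) = (fst v * snd f - snd v * fst f) * snd f"
    "snd v * (fst f * fst f + snd f * snd f) = (snd v * fst f - fst v * snd f) * fst f"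
    using 0 by algebra+
  then have "v = s *\<^sub>R (- snd f, fst f)"
    using nz by (auto simp: s_def prod_eq_iff field_simps)
  then show thesis by (rule that)
qed

text \<open>
  Take a section through a point \<open>p\<close> of the periodic orbit \<open>\<gamma>\<close>, orthogonal to \<open>f = X p\<close>. A
  solution \<open>\<phi>\<close> that starts on the section close to \<open>p\<close> stays close to \<open>\<gamma>\<close> beyond time \<open>T\<close>, and
  so it returns to the section near \<open>p\<close> at some time \<open>T'\<close> by the intermediate value theorem.
  Both points lie on the same level of \<open>H\<close>, which is injective on the section, so the return
  point is the starting point: \<open>\<phi>\<close> is periodic. Its orbit is as close to \<open>\<gamma>\<close> as desired, yet on
  another level of \<open>H\<close>.
\<close>

theorem lipschitz_hamiltonian_no_limit_cycle:
  fixes H :: "plane \<Rightarrow> real"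
  assumes X: "K-lipschitz_on UNIV X"
    and H: "\<And>p. (H has_derivative (\<lambda>v. fst (X p) * snd v - snd (X p) * fst v)) (at p)"
  shows "\<not> limit_cycle X C"
proof
  assume "limit_cycle X C"
  then obtain \<gamma> T e where \<gamma>: "is_solution X \<gamma>" and nonconst: "\<not> \<gamma> constant_on UNIV"
    and "T > 0" and per: "\<And>t. \<gamma> (t + T) = \<gamma> t" and C: "C = range \<gamma>"
    and "e > 0" and isolated: "\<And>D. D \<in> periodic_orbits X \<Longrightarrow> hausdorff_close e C D \<Longrightarrow> D = C"
    unfolding limit_cycle_def periodic_orbits_def by auto
  define p where "p = \<gamma> 0"
  define f where "f = X p"
  have "\<gamma> T = p"
    using per[of 0] by (simp add: p_def)
  have "f \<noteq> 0"
  proof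
    assume "f = 0"
    then have "is_solution X (\<lambda>t. p)"
      by (simp add: is_solution_def f_def)
    then have "\<gamma> = (\<lambda>t. p)"
      by (rule solution_unique[OF X \<gamma>]) (simp add: p_def)
    then show False
      using nonconst by (auto simp: constant_on_def)
  qed
  have cont_X: "continuous_on UNIV X"
    using X by (rule lipschitz_on_continuous_on)
  have "open {q. X q \<bullet> f > 0}"
    by (intro open_Collect_less continuous_intros cont_X)
  moreover have "p \<in> {q. X q \<bullet> f > 0}"
    using \<open>f \<noteq> 0\<close> by (simp add: f_def)
  ultimately obtain r where "r > 0" and transversal: "\<And>q. dist q p < r \<Longrightarrow> X q \<bullet> f > 0"
    unfolding open_dist by blast
  define \<sigma> where "\<sigma> s = p + s *\<^sub>R (- snd f, fst f)" for s
  have dist_\<sigma>: "dist (\<sigma> s) p = \<bar>s\<bar> * norm f" for s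
    by (simp add: \<sigma>_def dist_norm norm_quarter_turn del: scaleR_Pair)
  have H_inj: "s = s'" if "H (\<sigma> s) = H (\<sigma> s')" "dist (\<sigma> s) p < r" "dist (\<sigma> s') p < r" for s s'
  proof (rule ccontr)
    assume "s \<noteq> s'"
    then consider "s < s'" | "s' < s" by linarith
    then show False
    proof cases
      case 1
      from hamiltonian_increasing_on_section[where p = p and r = r, OF H transversal this, folded \<sigma>_def]
      show False
        using that by (simp add: dist_\<sigma>)
    next
      case 2
      from hamiltonian_increasing_on_section[where p = p and r = r, OF H transversal this, folded \<sigma>_def]
      show False
        using that by (simp add: dist_\<sigma>)
    qed
  qed
  have crossing: "((\<lambda>t. (\<gamma> t - p) \<bullet> f) has_real_derivative f \<bullet> f) (at T)"
  proof -
    have "(\<gamma> has_derivative (\<lambda>h. h *\<^sub>R f)) (at T)"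
      using \<gamma>[unfolded is_solution_def, rule_format, of T] \<open>\<gamma> T = p\<close>
      by (simp add: has_vector_derivative_def f_def)
    then show ?thesis
      unfolding has_field_derivative_def by (auto intro!: derivative_eq_intros simp: mult.commute)
  qed
  have "f \<bullet> f > 0"
    using \<open>f \<noteq> 0\<close> by simp
  obtain d1 where "d1 > 0" and d1: "\<And>h. 0 < h \<Longrightarrow> h < d1 \<Longrightarrow> (\<gamma> (T - h) - p) \<bullet> f < 0"
    using DERIV_pos_inc_left[OF crossing \<open>f \<bullet> f > 0\<close>] \<open>\<gamma> T = p\<close> by auto
  obtain d2 where "d2 > 0" and d2: "\<And>h. 0 < h \<Longrightarrow> h < d2 \<Longrightarrow> (\<gamma> (T + h) - p) \<bullet> f > 0"
    using DERIV_pos_inc_right[OF crossing \<open>f \<bullet> f > 0\<close>] \<open>\<gamma> T = p\<close> by auto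
  obtain d3 where "d3 > 0" and d3: "\<And>t. dist t T < d3 \<Longrightarrow> dist (\<gamma> t) p < r / 2"
    using solution_continuous[OF \<gamma>, of UNIV, unfolded continuous_on_iff, rule_format, of T "r / 2"]
      \<open>r > 0\<close> \<open>\<gamma> T = p\<close> by auto
  define \<delta> where "\<delta> = min (min d1 d2) (min d3 T) / 2"
  have \<delta>: "0 < \<delta>" "\<delta> < d1" "\<delta> < d2" "\<delta> < d3" "\<delta> < T"
    using \<open>d1 > 0\<close> \<open>d2 > 0\<close> \<open>d3 > 0\<close> \<open>T > 0\<close> by (auto simp: \<delta>_def)
  \<comment> \<open>A perturbation of size below \<open>\<mu>\<close> keeps \<open>\<gamma>\<close> on opposite sides of the section at times
      \<open>T - \<delta>\<close> and \<open>T + \<delta>\<close>.\<close>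
  define \<mu> where "\<mu> = min (- ((\<gamma> (T - \<delta>) - p) \<bullet> f)) ((\<gamma> (T + \<delta>) - p) \<bullet> f) / norm f"
  have "\<mu> > 0"
    using d1 d2 \<delta> \<open>f \<noteq> 0\<close> by (simp add: \<mu>_def)
  define \<eta> where "\<eta> = min e (min (r / 2) \<mu>)"
  have \<eta>: "0 < \<eta>" "\<eta> \<le> e" "\<eta> \<le> r / 2" "\<eta> \<le> \<mu>"
    using \<open>e > 0\<close> \<open>r > 0\<close> \<open>\<mu> > 0\<close> by (auto simp: \<eta>_def)
  \<comment> \<open>The starting point at parameter \<open>s\<close> has distance \<open>s * norm f\<close> from \<open>p\<close>, and the flow expands
      distances up to time \<open>T + \<delta>\<close> by at most the exponential factor.\<close>
  define s where "s = \<eta> / (2 * exp (K * (T + \<delta>)) * norm f)"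
  have "s > 0"
    using \<eta>(1) \<open>f \<noteq> 0\<close> by (simp add: s_def)
  obtain \<phi> where \<phi>: "is_solution X \<phi>" and "\<phi> 0 = \<sigma> s"
    using lipschitz_solution_exists[OF X] by blast
  have near: "dist (\<phi> t) (\<gamma> t) < \<eta>" if "0 \<le> t" "t \<le> T + \<delta>" for t
  proof -
    have "dist (\<phi> t) (\<gamma> t) \<le> exp (K * t) * dist (\<sigma> s) p"
      using solution_dist_forward[OF X \<phi> \<gamma> \<open>0 \<le> t\<close>] by (simp add: \<open>\<phi> 0 = \<sigma> s\<close> p_def)
    also have "\<dots> \<le> exp (K * (T + \<delta>)) * dist (\<sigma> s) p"
      using that lipschitz_on_nonneg[OF X] by (intro mult_right_mono) (auto intro: mult_left_mono)
    also have "\<dots> = \<eta> / 2"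
      using \<open>f \<noteq> 0\<close> \<eta>(1) by (simp add: dist_\<sigma> s_def)
    finally show ?thesis
      using \<eta>(1) by linarith
  qed
  have "dist (\<sigma> s) p < r"
    using near[of 0] \<eta> \<delta> \<open>T > 0\<close> by (simp add: \<open>\<phi> 0 = \<sigma> s\<close> p_def)
  have sign: "\<bar>(\<phi> t - \<gamma> t) \<bullet> f\<bar> < \<mu> * norm f" if "0 \<le> t" "t \<le> T + \<delta>" for t
  proof -
    have "\<bar>(\<phi> t - \<gamma> t) \<bullet> f\<bar> \<le> norm (\<phi> t - \<gamma> t) * norm f"
      by (rule Cauchy_Schwarz_ineq2)
    also have "\<dots> < \<mu> * norm f"
      using near[OF that] \<eta>(4) \<open>f \<noteq> 0\<close> by (intro mult_strict_right_mono) (auto simp: dist_norm)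
    finally show ?thesis .
  qed
  have mu: "\<mu> * norm f \<le> - ((\<gamma> (T - \<delta>) - p) \<bullet> f)" "\<mu> * norm f \<le> (\<gamma> (T + \<delta>) - p) \<bullet> f"
    using \<open>f \<noteq> 0\<close> by (auto simp: \<mu>_def)
  have "(\<phi> (T - \<delta>) - p) \<bullet> f \<le> 0"
    using sign[of "T - \<delta>"] mu(1) \<delta> by (simp add: inner_diff_left)
  moreover have "0 \<le> (\<phi> (T + \<delta>) - p) \<bullet> f"
    using sign[of "T + \<delta>"] mu(2) \<delta> by (simp add: inner_diff_left)
  moreover have "continuous_on {T - \<delta>..T + \<delta>} (\<lambda>t. (\<phi> t - p) \<bullet> f)"
    by (intro continuous_intros solution_continuous[OF \<phi>])
  ultimately obtain T' where T': "T - \<delta> \<le> T'" "T' \<le> T + \<delta>" and "(\<phi> T' - p) \<bullet> f = 0"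
    using IVT'[of "\<lambda>t. (\<phi> t - p) \<bullet> f" "T - \<delta>" 0 "T + \<delta>"] \<delta> by auto
  then obtain s' where "\<phi> T' - p = s' *\<^sub>R (- snd f, fst f)"
    using orthogonal_in_plane[OF \<open>f \<noteq> 0\<close>] by blast
  then have "\<phi> T' = \<sigma> s'"
    by (simp add: \<sigma>_def algebra_simps)
  have "T' > 0"
    using T' \<delta> by linarith
  have "dist (\<gamma> T') p < r / 2"
    using T' \<delta> by (intro d3) (auto simp: dist_real_def)
  moreover have "dist (\<phi> T') (\<gamma> T') < r / 2"
    using near[of T'] T' \<open>T' > 0\<close> \<eta>(3) by simp
  ultimately have "dist (\<sigma> s') p < r"
    using dist_triangle_half_r[of "\<gamma> T'" "\<phi> T'" r p] by (simp add: \<open>\<phi> T' = \<sigma> s'\<close> dist_commute)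
  moreover have "H (\<sigma> s') = H (\<sigma> s)"
    using solution_conserves_hamiltonian[OF H \<phi>, of T' 0] by (simp add: \<open>\<phi> T' = \<sigma> s'\<close> \<open>\<phi> 0 = \<sigma> s\<close>)
  ultimately have "\<phi> T' = \<phi> 0"
    using H_inj[of s' s] \<open>dist (\<sigma> s) p < r\<close> by (simp add: \<open>\<phi> T' = \<sigma> s'\<close> \<open>\<phi> 0 = \<sigma> s\<close>)
  then have per': "\<phi> (t + T') = \<phi> t" for t
    by (rule solution_periodic[OF X \<phi>])
  have "\<not> \<phi> constant_on UNIV"
  proof
    assume "\<phi> constant_on UNIV"
    then have "\<phi> = (\<lambda>t. \<sigma> s)"
      using \<open>\<phi> 0 = \<sigma> s\<close> by (auto simp: constant_on_def)
    moreover have "(\<phi> has_vector_derivative X (\<sigma> s)) (at 0)"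
      using \<phi>[unfolded is_solution_def, rule_format, of 0] \<open>\<phi> 0 = \<sigma> s\<close> by simp
    ultimately have "X (\<sigma> s) = 0"
      using vector_derivative_unique_at[OF _ has_vector_derivative_const] by metis
    then show False
      using transversal[OF \<open>dist (\<sigma> s) p < r\<close>] by simp
  qed
  then have "range \<phi> \<in> periodic_orbits X"
    using \<phi> per' \<open>T' > 0\<close> unfolding periodic_orbits_def by blast
  moreover have "hausdorff_close e C (range \<phi>)"
    unfolding hausdorff_close_def C
  proof (intro conjI ballI)
    fix q assume "q \<in> range \<gamma>"
    then obtain t where "t \<in> {0..T}" "q = \<gamma> t"
      using range_periodic[of \<gamma> T, OF per \<open>T > 0\<close>] by auto
    then have "dist q (\<phi> t) < e"
      using near[of t] \<eta>(2) \<delta>(1) by (simp add: dist_commute)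
    then show "\<exists>q'\<in>range \<phi>. dist q q' < e" by blast
  next
    fix q assume "q \<in> range \<phi>"
    then obtain t where "t \<in> {0..T'}" "q = \<phi> t"
      using range_periodic[of \<phi> T', OF per' \<open>T' > 0\<close>] by auto
    then have "dist (\<gamma> t) q < e"
      using near[of t] \<eta>(2) T' by (simp add: dist_commute)
    then show "\<exists>q'\<in>range \<gamma>. dist q' q < e" by blast
  qed
  ultimately have "range \<phi> = range \<gamma>"
    using isolated C by blast
  \<comment> \<open>Equal orbits would put \<open>\<sigma> s\<close> and \<open>\<sigma> 0 = p\<close> on the same level of \<open>H\<close>.\<close>
  then obtain t where "\<sigma> s = \<gamma> t"
    using \<open>\<phi> 0 = \<sigma> s\<close> by (metis rangeE rangeI)
  then have "H (\<sigma> s) = H (\<sigma> 0)"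
    using solution_conserves_hamiltonian[OF H \<gamma>, of t 0] by (simp add: \<sigma>_def p_def del: scaleR_Pair)
  then show False
    using H_inj[of s 0] \<open>dist (\<sigma> s) p < r\<close> \<open>r > 0\<close> \<open>s > 0\<close> by (simp add: dist_\<sigma>)
qed

section \<open>Piecewise linear Hamiltonian fields\<close>

text \<open>
  The difference of the two fields is affine and vanishes on the line \<open>n \<bullet> p = k\<close>, so it has the
  form \<open>(n \<bullet> p - k) w\<close> with a constant vector \<open>w\<close>. Its linear part has trace \<open>n \<bullet> w\<close>, which is zero
  since both fields are Hamiltonian. Thus \<open>w\<close> is parallel to the line.
\<close>

lemma continuous_hamiltonian_pair_difference:
  fixes n :: plane
  assumes "n \<noteq> 0"
    and X: "\<And>x y. X (x, y) = (a * x + b * y + \<alpha>, c * x - a * y + \<beta>)"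
    and Y: "\<And>x y. Y (x, y) = (a' * x + b' * y + \<alpha>', c' * x - a' * y + \<beta>')"
    and agree: "\<And>p. n \<bullet> p = k \<Longrightarrow> X p = Y p"
  obtains d where "\<And>p. Y p = X p + (d * (n \<bullet> p - k)) *\<^sub>R (snd n, - fst n)"
proof -
  obtain n1 n2 where n: "n = (n1, n2)" by (cases n)
  define N where "N = n1 * n1 + n2 * n2"
  define A B C where "A = a' - a" and "B = b' - b" and "C = c - c'"
  have "N \<noteq> 0"
    using \<open>n \<noteq> 0\<close> by (simp add: N_def n sum_squares_eq_zero_iff zero_prod_def)
  \<comment> \<open>\<open>(u, v)\<close> is the foot of the perpendicular from the origin; moving it by \<open>(- n2, n1)\<close> gives a
      second point of the line. Agreement at these two points determines the difference up to a
      scalar factor.\<close>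
  define u v where "u = k * n1 / N" and "v = k * n2 / N"
  have foot: "n1 * u + n2 * v = k"
  proof -
    have "n1 * u + n2 * v = k * N / N"
      by (simp add: u_def v_def N_def distrib_left add_divide_distrib mult_ac)
    then show ?thesis using \<open>N \<noteq> 0\<close> by simp
  qed
  have on_line: "A * x + B * y + (\<alpha>' - \<alpha>) = 0 \<and> C * x + A * y + (\<beta> - \<beta>') = 0"
    if "n1 * x + n2 * y = k" for x y
  proof -
    have "a * x + b * y + \<alpha> = a' * x + b' * y + \<alpha>'" "c * x - a * y + \<beta> = c' * x - a' * y + \<beta>'"
      using agree[of "(x, y)"] that by (simp_all add: n X Y)
    then show ?thesis
      unfolding A_def B_def C_def left_diff_distrib by linarith
  qed
  have "n1 * (u - n2) + n2 * (v + n1) = k"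
    using foot by (simp add: right_diff_distrib distrib_left)
  note E = on_line[OF foot] and E' = on_line[OF this]
  have D: "A * n2 = B * n1" "C * n2 = A * n1"
    using E E' unfolding right_diff_distrib distrib_left by linarith+
  define d where "d = (B + C) / N"
  have abc: "A = d * n1 * n2" "B = d * n2 * n2" "C = d * n1 * n1"
  proof -
    have "A * N = (B + C) * n1 * n2" "B * N = (B + C) * n2 * n2" "C * N = (B + C) * n1 * n1"
      unfolding N_def using D by algebra+
    then show "A = d * n1 * n2" "B = d * n2 * n2" "C = d * n1 * n1"
      using \<open>N \<noteq> 0\<close> by (simp_all add: d_def eq_divide_eq)
  qed
  have al: "\<alpha>' = \<alpha> - d * n2 * k" "\<beta>' = \<beta> + d * n1 * k"
    using E foot abc by algebra+
  have abc': "a' = a + d * n1 * n2" "b' = b + d * n2 * n2" "c' = c - d * n1 * n1"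
    using abc by (auto simp: A_def B_def C_def)
  have "Y p = X p + (d * (n \<bullet> p - k)) *\<^sub>R (snd n, - fst n)" for p
    by (cases p) (simp add: X Y n al abc' algebra_simps)
  then show thesis by (rule that)
qed

text \<open>
  The Hamiltonian of the correction term: unlike the positive part, its square is
  differentiable at 0.
\<close>

lemma has_derivative_half_square_positive_part:
  "((\<lambda>x::real. (max x 0)\<^sup>2 / 2) has_real_derivative max x 0) (at x)"
proof -
  have "((\<lambda>x::real. if x \<in> {0..} then x\<^sup>2 / 2 else 0) has_vector_derivative
      (if x \<in> {0..} then x else 0)) (at x within UNIV)"
  proof (rule has_vector_derivative_If_within_closures[where T = "{..0}"])
    show "((\<lambda>x::real. x\<^sup>2 / 2) has_vector_derivative x) (at x within S)" for S
      by (auto intro!: derivative_eq_intros simp flip: has_real_derivative_iff_has_vector_derivative)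
  qed auto
  moreover have "(\<lambda>x::real. if x \<in> {0..} then x\<^sup>2 / 2 else 0) = (\<lambda>x. (max x 0)\<^sup>2 / 2)"
    by (auto simp: max_def)
  moreover have "(if x \<in> {0..} then x else 0) = max x 0"
    by (simp add: max_def)
  ultimately show ?thesis
    by (simp add: has_real_derivative_iff_has_vector_derivative)
qed

lemma linear_hamiltonian_lipschitz:
  fixes X :: "plane \<Rightarrow> plane"
  assumes X: "\<And>x y. X (x, y) = (a * x + b * y + \<alpha>, c * x - a * y + \<beta>)"
  shows "\<exists>K. K-lipschitz_on UNIV X"
proof -
  define A where "A v = (a * fst v + b * snd v, c * fst v - a * snd v)" for v :: plane
  have "bounded_linear A"
    unfolding A_def by (intro bounded_linear_intros)
  then obtain K where K: "\<And>v. norm (A v) \<le> norm v * K" "K \<ge> 0"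
    using bounded_linear.nonneg_bounded by blast
  have "K-lipschitz_on UNIV X"
  proof (rule lipschitz_onI)
    fix p q
    have "X p - X q = A (p - q)"
      by (cases p; cases q) (simp add: X A_def algebra_simps)
    then show "dist (X p) (X q) \<le> K * dist p q"
      using K(1)[of "p - q"] by (simp add: dist_norm mult.commute)
  qed fact
  then show ?thesis by blast
qed

theorem theorem1:
  fixes n :: plane and k :: real
    and \<Sigma> R\<^sub>L R\<^sub>R :: "plane set"
    and X\<^sub>L X\<^sub>R :: "plane \<Rightarrow> plane"
  assumes "n \<noteq> 0"
    and "\<Sigma> = {p. n \<bullet> p = k}"
    and "R\<^sub>L = {p. n \<bullet> p < k}"
    and "R\<^sub>R = {p. n \<bullet> p > k}"
    and "linear_hamiltonian X\<^sub>L" and "linear_hamiltonian X\<^sub>R"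
    and "has_isolated_singular_point X\<^sub>L" and "has_isolated_singular_point X\<^sub>R"
    and "\<forall>p\<in>\<Sigma>. X\<^sub>L p = X\<^sub>R p"
  shows "\<not> (\<exists>C. limit_cycle (piecewise_field R\<^sub>L X\<^sub>L X\<^sub>R) C)"
proof -
  obtain a b c \<alpha> \<beta> where XL: "\<And>x y. X\<^sub>L (x, y) = (a * x + b * y + \<alpha>, c * x - a * y + \<beta>)"
    using \<open>linear_hamiltonian X\<^sub>L\<close> unfolding linear_hamiltonian_def by blast
  obtain a' b' c' \<alpha>' \<beta>' where
    XR: "\<And>x y. X\<^sub>R (x, y) = (a' * x + b' * y + \<alpha>', c' * x - a' * y + \<beta>')"
    using \<open>linear_hamiltonian X\<^sub>R\<close> unfolding linear_hamiltonian_def by blast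
  obtain d where d: "\<And>p. X\<^sub>R p = X\<^sub>L p + (d * (n \<bullet> p - k)) *\<^sub>R (snd n, - fst n)"
    using continuous_hamiltonian_pair_difference[OF \<open>n \<noteq> 0\<close> XL XR, of k] assms by auto
  define w where "w = d *\<^sub>R (snd n, - fst n)"
  define P where "P p = max (n \<bullet> p - k) 0" for p
  \<comment> \<open>Extend \<open>X\<^sub>L\<close> across the line and correct it on the right-hand side only; this gives one
      Lipschitz field on the plane with the Hamiltonian \<open>H\<close> below.\<close>
  define X where "X p = X\<^sub>L p + P p *\<^sub>R w" for p
  have field: "piecewise_field R\<^sub>L X\<^sub>L X\<^sub>R = X"
  proof
    fix p
    show "piecewise_field R\<^sub>L X\<^sub>L X\<^sub>R p = X p"
      using \<open>n \<noteq> 0\<close>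
      by (simp add: piecewise_field_def assms(3) X_def P_def w_def d mult.commute zero_prod_def)
  qed
  obtain K where K: "K-lipschitz_on UNIV X\<^sub>L"
    using linear_hamiltonian_lipschitz[OF XL] by blast
  have "(norm n * norm w)-lipschitz_on UNIV (\<lambda>p. P p *\<^sub>R w)"
  proof (rule lipschitz_onI)
    fix p q
    have "\<bar>P p - P q\<bar> \<le> \<bar>n \<bullet> (p - q)\<bar>"
      by (auto simp: P_def inner_diff_right)
    also have "\<dots> \<le> norm n * norm (p - q)"
      by (rule Cauchy_Schwarz_ineq2)
    finally have "\<bar>P p - P q\<bar> * norm w \<le> norm n * norm (p - q) * norm w"
      by (rule mult_right_mono) simp
    then show "dist (P p *\<^sub>R w) (P q *\<^sub>R w) \<le> norm n * norm w * dist p q"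
      by (simp add: dist_norm mult_ac flip: scaleR_diff_left)
  qed simp
  then have lip: "(K + norm n * norm w)-lipschitz_on UNIV X"
    unfolding X_def by (intro lipschitz_on_add K)
  define H where "H p = b / 2 * (snd p)\<^sup>2 - c / 2 * (fst p)\<^sup>2 + a * fst p * snd p
      + \<alpha> * snd p - \<beta> * fst p + d * ((P p)\<^sup>2 / 2)" for p
  have deriv: "(H has_derivative (\<lambda>v. fst (X p) * snd v - snd (X p) * fst v)) (at p)" for p
  proof -
    have "((\<lambda>p. n \<bullet> p - k) has_derivative (\<lambda>v. n \<bullet> v)) (at p)"
      by (auto intro!: derivative_eq_intros)
    from diff_chain_at[OF this
        has_derivative_half_square_positive_part[unfolded has_field_derivative_def]]
    have "((\<lambda>p. (P p)\<^sup>2 / 2) has_derivative (\<lambda>v. P p * (n \<bullet> v))) (at p)"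
      by (simp add: o_def P_def)
    note [derivative_intros] = this
    show ?thesis
      unfolding H_def
      by (cases p, rule derivative_eq_intros refl)+
         (auto simp: X_def XL w_def inner_prod_def algebra_simps power2_eq_square)
  qed
  show ?thesis
    using lipschitz_hamiltonian_no_limit_cycle[OF lip deriv] by (simp add: field)
qed

end
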